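(* Let $(X,\|\cdot\|)$ be a normed linear space over $\mathbb{K}$ ($\mathbb{K}=\mathbb{R}$ or $\mathbb{K}=\mathbb{C}$), let $n\ge 1$ be an integer and $\overline{\mathbf{x}}=(x_1,\dots,x_n)\in X^n$. Suppose there are $x\in X$ and $R>0$ such that $\|x_k-x\|\le R$ for every $k\in\{1,\dots,n\}$. Then for every $m\in\{1,\dots,n\}$, $$\left\|\mathcal{M}(\overline{\mathbf{x}})(m)-S_{m-1}(n)\cdot\frac1n\sum_{k=1}^n x_k\right\|\le R\sum_{k=1}^n\left|k^{m-1}-\frac1n S_{m-1}(n)\right|.$$
   Context: The discrete Mellin transform of $\overline{\mathbf{x}}=(x_1,\dots,x_n)\in X^n$ is $\mathcal{M}(\overline{\mathbf{x}})(m):=\sum_{k=1}^n k^{m-1}x_k$ for $m=1,\dots,n$. For $p\in\mathbb{R}$ and $n\in\mathbb{N}$, $S_p(n):=\sum_{k=1}^n k^p$. *)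

theory Defs
  imports Complex_Main
begin

text \<open>
  Normed linear spaces over a scalar field 'k, to be read with 'k = real or 'k = complex.
  (By the Gelfand--Mazur theorem, a type of class \<open>real_normed_field\<close> is isometrically
  isomorphic to one of these two.)  The class \<open>real_normed_vector\<close> supplies the norm on the
  space, and \<open>scale\<close> is a scalar multiplication by 'k that extends the real one; for
  'k = real it is forced to be \<open>scaleR\<close>, so that nothing is required beyond the class itself.
\<close>

locale normed_space_over = vector_space scale
  for scale :: "'k::real_normed_field \<Rightarrow> 'a::real_normed_vector \<Rightarrow> 'a" +
  assumes scale_of_real: "scale (of_real r) v = r *\<^sub>R v"
    and norm_scale: "norm (scale a v) = norm a * norm v"

lemma normed_space_over_real:
  "normed_space_over (scaleR :: real \<Rightarrow> 'a::real_normed_vector \<Rightarrow> 'a)"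
  by unfold_locales (auto simp: algebra_simps)

lemma normed_space_over_complex:
  "normed_space_over ((*) :: complex \<Rightarrow> complex \<Rightarrow> complex)"
  by unfold_locales (auto simp: algebra_simps norm_mult scaleR_conv_of_real)

text \<open>
  A tuple \<open>(x\<^sub>1, \<dots>, x\<^sub>n)\<close> is a function on \<open>nat\<close> of which only the values at \<open>1, \<dots>, n\<close> matter;
  the transform is meant for \<open>1 \<le> m \<le> n\<close>, where the natural subtraction is exact.
\<close>

definition discrete_Mellin ::
  "('k::real_normed_field \<Rightarrow> 'a::real_normed_vector \<Rightarrow> 'a) \<Rightarrow> nat \<Rightarrow> (nat \<Rightarrow> 'a) \<Rightarrow> nat \<Rightarrow> 'a"
  where "discrete_Mellin scale n x m = (\<Sum>k=1..n. scale (of_nat k ^ (m - 1)) (x k))"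

definition power_sum :: "real \<Rightarrow> nat \<Rightarrow> real"
  where "power_sum p n = (\<Sum>k=1..n. real k powr p)"

end

theory Submission
  imports Defs
begin

text \<open>Subtracting from the weights \<open>k ^ (m - 1)\<close> their mean leaves deviations
  \<open>b k\<close> with sum zero. The vector on the left is the sum of the
  \<open>b k\<close>-multiples of \<open>x k\<close>, and it is unchanged when every
  \<open>x k\<close> is replaced by \<open>x k - c\<close>; the triangle inequality then gives the
  bound. \<open>norm_sum_scaleR_diff_mean_le\<close> does this for arbitrary real weights.\<close>

text \<open>Summation starts at 1, so each base is positive and \<open>powr\<close> agrees with the
  natural power, also for exponent 0.\<close>

lemma power_sum_of_nat: "power_sum (real p) n = (\<Sum>k=1..n. real k ^ p)"
  unfolding power_sum_def by (intro sum.cong) (auto simp: powr_realpow)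

lemma norm_sum_scaleR_diff_mean_le:
  fixes a :: "'i \<Rightarrow> real" and x :: "'i \<Rightarrow> 'a::real_normed_vector"
  assumes "finite A" and "A \<noteq> {}" and R: "\<And>k. k \<in> A \<Longrightarrow> norm (x k - c) \<le> R"
  shows "norm ((\<Sum>k\<in>A. a k *\<^sub>R x k) - (sum a A / real (card A)) *\<^sub>R sum x A)
    \<le> R * (\<Sum>k\<in>A. \<bar>a k - sum a A / real (card A)\<bar>)"
proof -
  define b where "b k = a k - sum a A / real (card A)" for k
  have "card A \<noteq> 0"
    using assms by simp
  then have "sum b A = 0"
    by (simp add: b_def sum_subtractf)
  \<comment> \<open>The deviations \<open>b k\<close> of the weights sum to zero, so the centre \<open>c\<close> may be subtracted freely.\<close>
  then have "(\<Sum>k\<in>A. b k *\<^sub>R (x k - c)) = (\<Sum>k\<in>A. b k *\<^sub>R x k)"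
    by (simp add: scaleR_diff_right sum_subtractf flip: scaleR_left.sum)
  also have "\<dots> = (\<Sum>k\<in>A. a k *\<^sub>R x k) - (sum a A / real (card A)) *\<^sub>R sum x A"
    by (simp add: b_def scaleR_diff_left sum_subtractf scaleR_right.sum)
  finally have "norm ((\<Sum>k\<in>A. a k *\<^sub>R x k) - (sum a A / real (card A)) *\<^sub>R sum x A)
      = norm (\<Sum>k\<in>A. b k *\<^sub>R (x k - c))"
    by simp
  also have "\<dots> \<le> (\<Sum>k\<in>A. R * \<bar>b k\<bar>)"
    by (rule sum_norm_le) (simp add: R mult_right_mono mult.commute[of "\<bar>_\<bar>"])
  finally show ?thesis
    by (simp add: b_def sum_distrib_left)
qed

theorem theorem7:
  fixes scale :: "'k::real_normed_field \<Rightarrow> 'a::real_normed_vector \<Rightarrow> 'a"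
    and n :: nat and x :: "nat \<Rightarrow> 'a" and c :: 'a and R :: real
  assumes "normed_space_over scale"
    and "n \<ge> 1"
    and "R > 0"
    and "\<And>k. k \<in> {1..n} \<Longrightarrow> norm (x k - c) \<le> R"
  shows "\<forall>m\<in>{1..n}.
    norm (discrete_Mellin scale n x m
          - scale (of_real (power_sum (real m - 1) n)) (scale (1 / of_nat n) (\<Sum>k=1..n. x k)))
      \<le> R * (\<Sum>k=1..n. \<bar>real k ^ (m - 1) - 1 / real n * power_sum (real m - 1) n\<bar>)"
proof
  fix m assume m: "m \<in> {1..n}"
  interpret normed_space_over scale by fact
  \<comment> \<open>As m \<ge> 1, \<open>real m - 1\<close> is \<open>real (m - 1)\<close>.\<close>
  have S: "power_sum (real m - 1) n = (\<Sum>k=1..n. real k ^ (m - 1))"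
    using m power_sum_of_nat[of "m - 1" n] by (simp add: of_nat_diff)
  \<comment> \<open>All scalars involved are images of reals in \<open>'k\<close>, so
    \<open>scale\<close> reduces to \<open>scaleR\<close> and real weights suffice.\<close>
  have "discrete_Mellin scale n x m = (\<Sum>k=1..n. real k ^ (m - 1) *\<^sub>R x k)"
    by (simp add: discrete_Mellin_def flip: scale_of_real)
  moreover have "scale (1 / of_nat n) v = (1 / real n) *\<^sub>R v" for v
    by (simp flip: scale_of_real)
  ultimately show "norm (discrete_Mellin scale n x m
          - scale (of_real (power_sum (real m - 1) n)) (scale (1 / of_nat n) (\<Sum>k=1..n. x k)))
      \<le> R * (\<Sum>k=1..n. \<bar>real k ^ (m - 1) - 1 / real n * power_sum (real m - 1) n\<bar>)"
    using norm_sum_scaleR_diff_mean_le[of "{1..n}" x c R "\<lambda>k. real k ^ (m - 1)"] assms(2,4)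
    \<comment> \<open>\<open>of_real\<close> must stay outside the sum for
      \<open>scale_of_real\<close> to match.\<close>
    by (simp add: S scale_of_real del: of_real_sum)
qed

end
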